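(* Let $G$ be a finite simple graph with at least one edge, and let $\phi$ be a semi-transitive orientation of $G$. Then there exists an edge $e\in E(G)$ such that the restriction of $\phi$ to $G\setminus e$ is a semi-transitive orientation of $G\setminus e$.
   Context: Graphs are finite, undirected and simple. An orientation of a graph assigns to each edge one of its two directions; it is acyclic if it has no directed cycle. A digraph is transitive if whenever $v_1\to v_2$ and $v_2\to v_3$ are directed edges on three distinct vertices, $v_1\to v_3$ is also a directed edge. Given an acyclic orientation $\phi$ of a graph $G$, a shortcut in $\phi(G)$ is a non-transitive induced subdigraph of $\phi(G)$ on a vertex set $\{v_1,\dots,v_n\}$ with $n\ge 4$ (distinct vertices) that contains the directed path $v_1\to v_2\to\cdots\to v_n$ and the directed edge $v_1\to v_n$. An acyclic orientation $\phi$ is semi-transitive if $\phi(G)$ contains no shortcut. $G\setminus e$ denotes the graph obtained from $G$ by deleting the edge $e$ (keeping all vertices). *)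

theory Defs
  imports "Graph_Theory.Graph_Theory" "HOL-Library.FuncSet"
begin

text \<open>
  A finite simple graph is a \<^locale>\<open>pair_graph\<close>: each undirected edge is represented by both of
  its arcs, so an edge proper is the two-element set of its ends.
\<close>

definition edges :: "'a pair_pre_digraph \<Rightarrow> 'a set set" where
  "edges G = (\<lambda>(u, v). {u, v}) ` parcs G"

definition del_edge :: "'a pair_pre_digraph \<Rightarrow> 'a set \<Rightarrow> 'a pair_pre_digraph" where
  "del_edge G e = \<lparr> pverts = pverts G, parcs = {(u, v) \<in> parcs G. {u, v} \<noteq> e} \<rparr>"

lemma pair_graph_del_edge:
  assumes "pair_graph G"
  shows "pair_graph (del_edge G e)"
proof -
  interpret pair_graph G by fact
  have "finite (parcs (del_edge G e))"
    using pair_finite_arcs by (rule finite_subset[rotated]) (auto simp: del_edge_def)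
  then show ?thesis
    using pair_finite_verts pair_no_loops arcs_symmetric
    by unfold_locales
      (auto simp: del_edge_def symmetric_def sym_def insert_commute dest: wellformed')
qed

lemma edges_del_edge: "edges (del_edge G e) = edges G - {e}"
  by (auto simp: edges_def del_edge_def)

text \<open>The arc \<open>(u, v)\<close> is directed from \<open>u\<close> to \<open>v\<close>.\<close>

definition orientation :: "'a pair_pre_digraph \<Rightarrow> ('a set \<Rightarrow> 'a \<times> 'a) \<Rightarrow> bool" where
  "orientation G \<phi> \<longleftrightarrow> \<phi> \<in> (\<Pi>\<^sub>E e\<in>edges G. {(u, v). {u, v} = e})"

definition oriented :: "('a set \<Rightarrow> 'a \<times> 'a) \<Rightarrow> 'a pair_pre_digraph \<Rightarrow> 'a pair_pre_digraph" where
  "oriented \<phi> G = \<lparr> pverts = pverts G, parcs = \<phi> ` edges G \<rparr>"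

definition acyclic_orientation :: "'a pair_pre_digraph \<Rightarrow> ('a set \<Rightarrow> 'a \<times> 'a) \<Rightarrow> bool" where
  "acyclic_orientation G \<phi> \<longleftrightarrow>
     orientation G \<phi> \<and> \<not> (\<exists>p. pre_digraph.cycle (with_proj (oriented \<phi> G)) p)"

definition transitive_digraph :: "('a, 'b) pre_digraph \<Rightarrow> bool" where
  "transitive_digraph D \<longleftrightarrow>
     (\<forall>u v w. distinct [u, v, w] \<and> u \<rightarrow>\<^bsub>D\<^esub> v \<and> v \<rightarrow>\<^bsub>D\<^esub> w \<longrightarrow> u \<rightarrow>\<^bsub>D\<^esub> w)"

definition shortcut :: "('a, 'b) pre_digraph \<Rightarrow> ('a, 'b) pre_digraph \<Rightarrow> bool" where
  "shortcut D H \<longleftrightarrow>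
     induced_subgraph H D \<and> \<not> transitive_digraph H \<and>
     (\<exists>vs. 4 \<le> length vs \<and> verts H = set vs \<and> vpath vs H \<and> hd vs \<rightarrow>\<^bsub>H\<^esub> last vs)"

definition semi_transitive :: "'a pair_pre_digraph \<Rightarrow> ('a set \<Rightarrow> 'a \<times> 'a) \<Rightarrow> bool" where
  "semi_transitive G \<phi> \<longleftrightarrow>
     acyclic_orientation G \<phi> \<and> \<not> (\<exists>H. shortcut (with_proj (oriented \<phi> G)) H)"

end

theory Submission
  imports Defs
begin

text \<open>
  Delete an arc \<open>a \<rightarrow> b\<close> for which there is no vertex \<open>c\<close> with \<open>a \<rightarrow> c \<rightarrow> b\<close>; an arc into a minimal
  vertex among those of positive in-degree has this property. Suppose that the deletion creates a
  shortcut on the vertex set \<open>S\<close>. The original digraph contains the same path and closing arc, so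
  its restriction to \<open>S\<close> must be transitive. Hence the only pair on which transitivity can fail
  after the deletion is \<open>(a, b)\<close>, and this would need a vertex \<open>c\<close> with \<open>a \<rightarrow> c \<rightarrow> b\<close>.
\<close>

lemma acyclic_relation_ex_uncomposed_pair:
  assumes "finite r" "acyclic r" "r \<noteq> {}"
  obtains a b where "(a, b) \<in> r" "\<And>c. (a, c) \<in> r \<Longrightarrow> (c, b) \<notin> r"
proof -
  have "wf r" using assms by (simp add: finite_acyclic_wf)
  moreover obtain x where "x \<in> Range r" using assms by auto
  ultimately obtain b where b: "b \<in> Range r" "\<And>c. (c, b) \<in> r \<Longrightarrow> c \<notin> Range r"
    by (rule wfE_min) blast
  \<comment> \<open>Take any predecessor of \<open>b\<close> as \<open>a\<close>: a vertex
    \<open>c\<close> between them would lie in \<open>Range r\<close> and precede \<open>b\<close>,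
    against minimality.\<close>
  then show ?thesis using that by blast
qed

text \<open>A nonempty closed walk contains a cycle. This turns the absence of graph cycles into the
  acyclicity of a relation, from which well-foundedness follows.\<close>

lemma (in wf_digraph) acyclic_arcs_ends:
  assumes "\<nexists>p. cycle p"
  shows "acyclic (arcs_ends G)"
proof (rule acyclicI, intro allI notI)
  fix x assume "x \<rightarrow>\<^sup>+ x"
  then obtain p where "awalk x p x" "p \<noteq> []" by (auto simp: reachable1_awalk)
  then show False using assms closed_w_imp_cycle unfolding closed_w_def by blast
qed

lemma orientation_endpoints:
  assumes "orientation G \<phi>" "e \<in> edges G"
  shows "{fst (\<phi> e), snd (\<phi> e)} = e"
proof -
  have "\<phi> e \<in> {(u, v). {u, v} = e}" using assms unfolding orientation_def by (rule PiE_mem)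
  then show ?thesis by (cases "\<phi> e") simp
qed

lemma arcs_ends_with_proj: "arcs_ends (with_proj D) = parcs D"
  by (auto simp: arcs_ends_conv)

lemma wf_digraph_oriented:
  assumes "pair_graph G" "orientation G \<phi>"
  shows "pair_wf_digraph (oriented \<phi> G)"
proof -
  interpret pair_graph G by fact
  have "fst (\<phi> e) \<in> pverts G \<and> snd (\<phi> e) \<in> pverts G" if "e \<in> edges G" for e
  proof -
    have "e \<subseteq> pverts G" using that wellformed' by (auto simp: edges_def)
    then show ?thesis using orientation_endpoints[OF assms(2) that] by blast
  qed
  then show ?thesis
    unfolding pair_wf_digraph_def oriented_def pair_pre_digraph.simps by blast
qed

lemma finite_edges:
  assumes "pair_graph G"
  shows "finite (edges G)"
proof -
  interpret pair_graph G by fact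
  show ?thesis using pair_finite_arcs by (simp add: edges_def)
qed

lemma orientation_del_edge:
  assumes "orientation G \<phi>"
  shows "orientation (del_edge G e) (restrict \<phi> (edges (del_edge G e)))"
  unfolding orientation_def
\<comment> \<open>\<open>restrict\<close> supplies the extensionality demanded by
  \<open>\<Pi>\<^sub>E\<close>, so only the values on surviving edges remain to be checked.\<close>
proof (rule restrict_PiE_iff[THEN iffD2], intro ballI)
  fix f assume "f \<in> edges (del_edge G e)"
  then have "f \<in> edges G" by (simp add: edges_del_edge)
  with assms show "\<phi> f \<in> {(u, v). {u, v} = f}" unfolding orientation_def by (rule PiE_mem)
qed

lemma oriented_del_edge:
  assumes "orientation G \<phi>" "e \<in> edges G"
  shows "oriented (restrict \<phi> (edges (del_edge G e))) (del_edge G e) =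
    \<lparr> pverts = pverts G, parcs = parcs (oriented \<phi> G) - {\<phi> e} \<rparr>"
proof -
  \<comment> \<open>An edge is recovered from its arc as the set of its ends. Injectivity ensures
    that no other edge keeps the arc \<open>\<phi> e\<close> alive.\<close>
  have "inj_on \<phi> (edges G)"
    using orientation_endpoints[OF assms(1)] by (metis inj_onI)
  then have "\<phi> ` (edges G - {e}) = \<phi> ` edges G - {\<phi> e}"
    using assms(2) by (auto dest: inj_onD)
  then show ?thesis by (simp add: oriented_def edges_del_edge) (simp add: del_edge_def)
qed

lemma shortcut_insert_uncomposed_arc:
  fixes D :: "'a pair_pre_digraph"
  defines "D' a b \<equiv> \<lparr> pverts = pverts D, parcs = parcs D - {(a, b)} \<rparr>"
  assumes wf: "pair_wf_digraph D"
    and sc: "shortcut (with_proj (D' a b)) H"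
    and uncomposed: "\<And>c. (a, c) \<in> parcs D \<Longrightarrow> (c, b) \<notin> parcs D"
  shows "shortcut (with_proj D) (with_proj D \<restriction> verts H)"
proof -
  let ?K = "with_proj D \<restriction> verts H"
  interpret D: pair_wf_digraph D by (rule wf)
  have ind: "induced_subgraph H (with_proj (D' a b))" using sc by (simp add: shortcut_def)
  then have VH: "verts H \<subseteq> pverts D" by (auto simp: induced_subgraph_def subgraph_def D'_def)
  \<comment> \<open>Paths and transitivity depend only on \<open>verts\<close> and
    \<open>arcs_ends\<close>, so \<open>H\<close> and \<open>?K\<close> are compared through
    these.\<close>
  have endsH: "arcs_ends H = {(u, v) \<in> parcs D. u \<in> verts H \<and> v \<in> verts H} - {(a, b)}"
    using ind
    by (auto simp: induced_subgraph_def subgraph_def compatible_def D'_def arcs_ends_conv)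
  have endsK: "arcs_ends ?K = {(u, v) \<in> parcs D. u \<in> verts H \<and> v \<in> verts H}"
    by (auto simp: arcs_ends_conv)
  have "\<not> transitive_digraph H" using sc by (simp add: shortcut_def)
  \<comment> \<open>Let u, v, w violate transitivity in \<open>H\<close>. If (u, w) were an arc of
    \<open>?K\<close>, it would be \<open>(a, b)\<close>, and v would be a forbidden
    \<open>c\<close>; so the same triple violates it in \<open>?K\<close>.\<close>
  then have "\<not> transitive_digraph ?K"
    using uncomposed unfolding transitive_digraph_def endsH endsK by blast
  moreover have "induced_subgraph ?K (with_proj D)"
    using VH by (intro D.induced_induce) simp
  moreover obtain vs where "4 \<le> length vs" "verts H = set vs" "vpath vs H" "hd vs \<rightarrow>\<^bsub>H\<^esub> last vs"
    using sc by (auto simp: shortcut_def)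
  moreover have "arcs_ends H \<subseteq> arcs_ends ?K" unfolding endsH endsK by blast
  ultimately show ?thesis
    unfolding shortcut_def vpath_def vwalk_def by auto
qed

theorem theorem1p7:
  fixes G :: "'a pair_pre_digraph" and \<phi> :: "'a set \<Rightarrow> 'a \<times> 'a"
  assumes "pair_graph G"
    and "edges G \<noteq> {}"
    and "semi_transitive G \<phi>"
  shows "\<exists>e\<in>edges G. semi_transitive (del_edge G e) (restrict \<phi> (edges (del_edge G e)))"
proof -
  let ?D = "oriented \<phi> G"
  have ori: "orientation G \<phi>" and nocyc: "\<nexists>p. pre_digraph.cycle (with_proj ?D) p"
    and nosc: "\<nexists>H. shortcut (with_proj ?D) H"
    using assms(3) by (auto simp: semi_transitive_def acyclic_orientation_def)
  interpret D: pair_wf_digraph ?D using assms(1) ori by (rule wf_digraph_oriented)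
  have "finite (parcs ?D)" "parcs ?D \<noteq> {}"
    using finite_edges[OF assms(1)] assms(2) by (auto simp: oriented_def)
  moreover have "acyclic (parcs ?D)"
    using D.acyclic_arcs_ends nocyc by (simp add: arcs_ends_with_proj)
  ultimately obtain a b where ab: "(a, b) \<in> parcs ?D"
    and uncomposed: "\<And>c. (a, c) \<in> parcs ?D \<Longrightarrow> (c, b) \<notin> parcs ?D"
    using acyclic_relation_ex_uncomposed_pair by metis
  from ab obtain e where e: "e \<in> edges G" "\<phi> e = (a, b)" by (auto simp: oriented_def)
  let ?D' = "oriented (restrict \<phi> (edges (del_edge G e))) (del_edge G e)"
  have D': "?D' = \<lparr> pverts = pverts ?D, parcs = parcs ?D - {(a, b)} \<rparr>"
    using oriented_del_edge[OF ori e(1)] e(2) by (simp add: oriented_def)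
  have ori': "orientation (del_edge G e) (restrict \<phi> (edges (del_edge G e)))"
    using ori by (rule orientation_del_edge)
  interpret D': pair_wf_digraph ?D'
    using pair_graph_del_edge[OF assms(1)] ori' by (rule wf_digraph_oriented)
  have "subgraph (with_proj ?D') (with_proj ?D)"
    unfolding subgraph_def compatible_def
    using D.wf_digraph_axioms D'.wf_digraph_axioms by (simp add: D')
  then have "\<nexists>p. pre_digraph.cycle (with_proj ?D') p"
    using D.subgraph_cycle nocyc by blast
  \<comment> \<open>A shortcut after the deletion would give one of \<open>?D\<close> on the same
    vertices.\<close>
  moreover have "\<nexists>H. shortcut (with_proj ?D') H"
    using shortcut_insert_uncomposed_arc[OF D.pair_wf_digraph_axioms] uncomposed nosc
    unfolding D' by blast
  ultimately show ?thesis
    using ori' e(1) by (auto simp: semi_transitive_def acyclic_orientation_def)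
qed

end
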